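(* Let $g\Gamma_{\mathbb{Z}} := \mathbb{Z}[\beta][gp_1, gp_2, gp_3, \dots]$ be the $\mathbb{Z}[\beta]$-subalgebra of $\Lambda$ generated by all the symmetric functions $gp_n$ ($n\ge 1$). Then $$g\Gamma_{\mathbb{Z}} = \mathbb{Z}[\beta][gp_1, gp_3, gp_5, \dots],$$ i.e. $g\Gamma_{\mathbb{Z}}$ is generated as a $\mathbb{Z}[\beta]$-algebra by the $gp_m$ with $m$ odd.
   Context: $\beta$ is a formal parameter, and $\overline{z} := \frac{-z}{1+\beta z}$ (expanded as a power series in $z$). $\Lambda$ is the $\mathbb{Q}(\beta)$-algebra of symmetric functions in infinitely many variables $x=(x_1,x_2,\dots)$. The symmetric functions $q_n^{[\beta]}=q_n^{[\beta]}(x)\in\Lambda$ are defined by $$\sum_{n=0}^\infty q_n^{[\beta]} z^n = \prod_i \frac{1 - x_i \overline{z}}{1 - x_i z}.$$ The symmetric functions $gp_n=gp_n(x)$, $n\geq 1$, are defined by $$\sum_{n=1}^\infty gp_n z^n = \frac{1}{2 + \beta z} \sum_{n=1}^\infty q_n^{[\beta]} z^n ,$$ where $\frac{1}{2+\beta z}$ is expanded as a power series in $z$. *)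

theory Defs
  imports
    "HOL-Computational_Algebra.Polynomial"
    "HOL-Computational_Algebra.Fraction_Field"
    "HOL-Computational_Algebra.Formal_Power_Series"
    "HOL-Library.Multiset"
begin

section \<open>Formal power series in countably many variables\<close>

text \<open>
  A monomial in the variables \<open>x\<^sub>0, x\<^sub>1, \<dots>\<close> is a finite multiset of indices: \<open>count m i\<close> is the
  exponent of \<open>x\<^sub>i\<close>, \<open>size m\<close> the total degree, and multiset sum is the product of monomials.
\<close>

typedef 'a mvs = "UNIV :: (nat multiset \<Rightarrow> 'a) set"
  morphisms mcoeff MVS
  by simp

lemma mcoeff_MVS [simp]: "mcoeff (MVS f) = f"
  by (simp add: MVS_inverse)

lemma mvs_eqI: "(\<And>m. mcoeff f m = mcoeff g m) \<Longrightarrow> f = g"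
  by (metis ext mcoeff_inject)

lemma finite_submsets: "finite {a. a \<subseteq># (m :: 'b multiset)}"
proof (induction m)
  case empty
  have "{a. a \<subseteq># ({#} :: 'b multiset)} = {{#}}" by auto
  then show ?case by simp
next
  case (add x m)
  have "{a. a \<subseteq># add_mset x m} \<subseteq> {a. a \<subseteq># m} \<union> add_mset x ` {a. a \<subseteq># m}"
  proof
    fix a assume a: "a \<in> {a. a \<subseteq># add_mset x m}"
    show "a \<in> {a. a \<subseteq># m} \<union> add_mset x ` {a. a \<subseteq># m}"
    proof (cases "x \<in># a")
      case True
      then obtain b where b: "a = add_mset x b" by (metis insert_DiffM)
      with a show ?thesis by auto
    next
      case False
      with a have "count a y \<le> count m y" for y
        by (cases "y = x") (auto simp: subseteq_mset_def not_in_iff dest: spec[of _ y])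
      then have "a \<subseteq># m" by (simp add: subseteq_mset_def)
      then show ?thesis by simp
    qed
  qed
  then show ?case using add finite_subset by blast
qed

instantiation mvs :: (comm_ring_1) comm_ring_1
begin

definition "0 = MVS (\<lambda>m. 0)"
definition "1 = MVS (\<lambda>m. if m = {#} then 1 else 0)"
definition "f + g = MVS (\<lambda>m. mcoeff f m + mcoeff g m)"
definition "f - g = MVS (\<lambda>m. mcoeff f m - mcoeff g m)"
definition "- f = MVS (\<lambda>m. - mcoeff f m)"
definition "f * g = MVS (\<lambda>m. \<Sum>a\<in>{a. a \<subseteq># m}. mcoeff f a * mcoeff g (m - a))"

instance
proof
  fix f g h :: "'a mvs"
  show "f * g * h = f * (g * h)"
  proof (rule mvs_eqI)
    fix m
    have "mcoeff (f * g * h) m =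
        (\<Sum>c\<in>{c. c \<subseteq># m}. \<Sum>a\<in>{a. a \<subseteq># c}. mcoeff f a * mcoeff g (c - a) * mcoeff h (m - c))"
      by (simp add: times_mvs_def sum_distrib_right)
    also have "\<dots> = (\<Sum>(c,a)\<in>Sigma {c. c \<subseteq># m} (\<lambda>c. {a. a \<subseteq># c}).
        mcoeff f a * mcoeff g (c - a) * mcoeff h (m - c))"
      by (subst sum.Sigma) (auto simp: finite_submsets)
    also have "\<dots> = (\<Sum>(a,b)\<in>Sigma {a. a \<subseteq># m} (\<lambda>a. {b. b \<subseteq># m - a}).
        mcoeff f a * (mcoeff g b * mcoeff h (m - a - b)))"
    proof (rule sum.reindex_bij_witness[of _ "\<lambda>(a,b). (a + b, a)" "\<lambda>(c,a). (a, c - a)"],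
        goal_cases)
      case (1 p) then show ?case by (auto simp: subset_mset.add_diff_inverse)
    next
      case (2 p) then show ?case
        by (auto simp: subseteq_mset_def intro: le_trans intro!: diff_le_mono)
    next
      case (3 p) then show ?case by auto
    next
      case (4 p) then show ?case
        by (auto simp: subset_eq_diff_conv subset_mset.le_diff_conv2 add.commute)
    next
      case (5 p)
      have "m - a - (c - a) = m - c" if "a \<subseteq># c" for a c
        using that by (simp add: diff_diff_add_mset subset_mset.add_diff_inverse)
      with 5 show ?case by (auto simp: mult.assoc)
    qed
    also have "\<dots> = mcoeff (f * (g * h)) m"
      by (subst sum.Sigma[symmetric])
        (auto simp: finite_submsets times_mvs_def sum_distrib_left)
    finally show "mcoeff (f * g * h) m = mcoeff (f * (g * h)) m" .
  qed
  show "f * g = g * f"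
  proof (rule mvs_eqI)
    fix m :: "nat multiset"
    have dd: "m - (m - a) = a" if "a \<subseteq># m" for a
      using that by (auto simp: multiset_eq_iff subseteq_mset_def)
    show "mcoeff (f * g) m = mcoeff (g * f) m"
      unfolding times_mvs_def mcoeff_MVS
      by (rule sum.reindex_bij_witness[of _ "\<lambda>a. m - a" "\<lambda>a. m - a"])
        (auto simp: dd mult.commute)
  qed
  show "1 * f = f"
  proof (rule mvs_eqI)
    fix m
    have "mcoeff (1 * f) m = (\<Sum>a\<in>{a. a \<subseteq># m}. if a = {#} then mcoeff f m else 0)"
      unfolding times_mvs_def one_mvs_def mcoeff_MVS by (rule sum.cong) auto
    also have "\<dots> = mcoeff f m" by (simp add: finite_submsets)
    finally show "mcoeff (1 * f) m = mcoeff f m" .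
  qed
  show "(f + g) * h = f * h + g * h"
    by (rule mvs_eqI) (simp add: times_mvs_def plus_mvs_def algebra_simps sum.distrib)
  show "f + g + h = f + (g + h)" by (rule mvs_eqI) (simp add: plus_mvs_def add.assoc)
  show "f + g = g + f" by (rule mvs_eqI) (simp add: plus_mvs_def add.commute)
  show "0 + f = f" by (rule mvs_eqI) (simp add: plus_mvs_def zero_mvs_def)
  show "- f + f = 0" by (rule mvs_eqI) (simp add: plus_mvs_def zero_mvs_def uminus_mvs_def)
  show "f - g = f + - g" by (rule mvs_eqI) (simp add: plus_mvs_def minus_mvs_def uminus_mvs_def)
  show "(0 :: 'a mvs) \<noteq> 1"
  proof
    assume "(0 :: 'a mvs) = 1"
    then have "mcoeff (0 :: 'a mvs) {#} = mcoeff 1 {#}" by (rule arg_cong)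
    then show False by (simp add: one_mvs_def zero_mvs_def)
  qed
qed

end

definition mvar :: "nat \<Rightarrow> 'a::comm_ring_1 mvs"
  where "mvar i = MVS (\<lambda>m. if m = {#i#} then 1 else 0)"

definition mconst :: "'a \<Rightarrow> 'a::comm_ring_1 mvs"
  where "mconst c = MVS (\<lambda>m. if m = {#} then c else 0)"

definition fps_mconst :: "'a fps \<Rightarrow> 'a::comm_ring_1 mvs fps"
  where "fps_mconst F = Abs_fps (\<lambda>n. mconst (fps_nth F n))"


section \<open>Symmetric functions over \<open>\<rat>(\<beta>)\<close>\<close>

type_synonym Qbeta = "rat poly fract"

definition poly_embed :: "rat poly \<Rightarrow> Qbeta"
  where "poly_embed p = Fract p 1"

definition beta :: Qbeta
  where "beta = poly_embed [:0, 1:]"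

definition Zbeta :: "Qbeta set"
  where "Zbeta = range (\<lambda>p :: int poly. poly_embed (map_poly of_int p))"

definition symmetric :: "'a mvs \<Rightarrow> bool"
  where "symmetric f \<longleftrightarrow> (\<forall>\<pi>. bij \<pi> \<longrightarrow> (\<forall>m. mcoeff f (image_mset \<pi> m) = mcoeff f m))"

definition bounded_degree :: "'a::zero mvs \<Rightarrow> bool"
  where "bounded_degree f \<longleftrightarrow> (\<exists>d. \<forall>m. mcoeff f m \<noteq> 0 \<longrightarrow> size m \<le> d)"

definition Lam :: "Qbeta mvs set"
  where "Lam = {f. symmetric f \<and> bounded_degree f}"

definition Zbeta_subalgebra :: "Qbeta mvs set \<Rightarrow> bool"
  where "Zbeta_subalgebra A \<longleftrightarrow> A \<subseteq> Lam \<and> 1 \<in> A \<and>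
    (\<forall>f\<in>A. \<forall>g\<in>A. f + g \<in> A) \<and> (\<forall>f\<in>A. \<forall>g\<in>A. f * g \<in> A) \<and>
    (\<forall>c\<in>Zbeta. \<forall>f\<in>A. mconst c * f \<in> A)"

text \<open>
  The subalgebra generated by \<open>S\<close>, as the intersection of all subalgebras of \<open>\<Lambda>\<close> containing \<open>S\<close>.
  This is only meaningful for \<open>S \<subseteq> Lam\<close> (otherwise the intersection is over the empty family).
\<close>
definition Zbeta_adjoin :: "Qbeta mvs set \<Rightarrow> Qbeta mvs set"
  where "Zbeta_adjoin S = Zbeta_subalgebra hull S"


section \<open>The functions \<open>q\<^sub>n\<close> and \<open>gp\<^sub>n\<close>\<close>

definition zbar :: "Qbeta fps"
  where "zbar = - fps_X / (1 + fps_const beta * fps_X)"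

text \<open>\<open>fps_right_inverse F 1\<close> is the inverse of a series \<open>F\<close> with constant term \<open>1\<close>.\<close>
definition q_factor :: "nat \<Rightarrow> Qbeta mvs fps"
  where "q_factor i = (1 - fps_const (mvar i) * fps_mconst zbar)
    * fps_right_inverse (1 - fps_const (mvar i) * fps_X) 1"

text \<open>
  Convergence in \<open>R[[x\<^sub>0, x\<^sub>1, \<dots>]][[z]]\<close>: every coefficient is eventually constant.
\<close>
definition coeffwise_lim :: "(nat \<Rightarrow> 'a mvs fps) \<Rightarrow> 'a mvs fps \<Rightarrow> bool"
  where "coeffwise_lim F L \<longleftrightarrow>
    (\<forall>n m. \<forall>\<^sub>F N in sequentially. mcoeff (fps_nth (F N) n) m = mcoeff (fps_nth L n) m)"

definition q_gf :: "Qbeta mvs fps"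
  where "q_gf = (THE L. coeffwise_lim (\<lambda>N. \<Prod>i<N. q_factor i) L)"

definition qb :: "nat \<Rightarrow> Qbeta mvs"
  where "qb n = fps_nth q_gf n"

definition gp_gf :: "Qbeta mvs fps"
  where "gp_gf = fps_mconst (1 / (2 + fps_const beta * fps_X))
    * Abs_fps (\<lambda>n. if n \<ge> 1 then qb n else 0)"

text \<open>Only used for \<open>n \<ge> 1\<close>; \<open>gp 0 = 0\<close>.\<close>
definition gp :: "nat \<Rightarrow> Qbeta mvs"
  where "gp n = fps_nth gp_gf n"

definition gGamma_Z :: "Qbeta mvs set"
  where "gGamma_Z = Zbeta_adjoin {gp n | n. n \<ge> 1}"


section \<open>The limit exists and \<open>gp\<^sub>n\<close> lies in \<open>\<Lambda>\<close>\<close>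

lemma mcoeff_zero [simp]: "mcoeff 0 m = 0"
  and mcoeff_one: "mcoeff 1 m = (if m = {#} then 1 else 0)"
  and mcoeff_add [simp]: "mcoeff (f + g) m = mcoeff f m + mcoeff g m"
  and mcoeff_diff [simp]: "mcoeff (f - g) m = mcoeff f m - mcoeff g m"
  and mcoeff_uminus [simp]: "mcoeff (- f) m = - mcoeff f m"
  and mcoeff_mult: "mcoeff (f * g) m = (\<Sum>a\<in>{a. a \<subseteq># m}. mcoeff f a * mcoeff g (m - a))"
  by (simp_all add: zero_mvs_def one_mvs_def plus_mvs_def minus_mvs_def uminus_mvs_def
      times_mvs_def)

lemma mcoeff_sum [simp]: "mcoeff (sum f A) m = (\<Sum>a\<in>A. mcoeff (f a) m)"
  by (induction A rule: infinite_finite_induct) simp_all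

lemma mcoeff_mconst_mult [simp]: "mcoeff (mconst c * f) m = c * mcoeff f m"
proof -
  have "mcoeff (mconst c * f) m = (\<Sum>a\<in>{a. a \<subseteq># m}. if a = {#} then c * mcoeff f m else 0)"
    unfolding mcoeff_mult mconst_def mcoeff_MVS by (rule sum.cong) auto
  also have "\<dots> = c * mcoeff f m" by (simp add: finite_submsets)
  finally show ?thesis .
qed

definition mdeg_le :: "nat \<Rightarrow> 'a::zero mvs \<Rightarrow> bool"
  where "mdeg_le d f \<longleftrightarrow> (\<forall>m. mcoeff f m \<noteq> 0 \<longrightarrow> size m \<le> d)"

lemma mdeg_le_mono: "mdeg_le d f \<Longrightarrow> d \<le> e \<Longrightarrow> mdeg_le e f"
  unfolding mdeg_le_def using le_trans by blast

lemma mdeg_le_add: "mdeg_le d f \<Longrightarrow> mdeg_le d g \<Longrightarrow> mdeg_le d (f + g)"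
  unfolding mdeg_le_def by (metis add.left_neutral mcoeff_add)

lemma mdeg_le_diff: "mdeg_le d f \<Longrightarrow> mdeg_le d g \<Longrightarrow> mdeg_le d (f - g)"
  unfolding mdeg_le_def by (metis diff_zero mcoeff_diff)

lemma mdeg_le_sum: "(\<And>a. a \<in> A \<Longrightarrow> mdeg_le d (f a)) \<Longrightarrow> mdeg_le d (sum f A)"
  by (induction A rule: infinite_finite_induct) (simp_all add: mdeg_le_add, simp_all add: mdeg_le_def)

lemma mdeg_le_mult: "mdeg_le d f \<Longrightarrow> mdeg_le e g \<Longrightarrow> mdeg_le (d + e) (f * g)"
  unfolding mdeg_le_def
proof (intro allI impI)
  fix m assume f: "\<forall>m. mcoeff f m \<noteq> 0 \<longrightarrow> size m \<le> d"
    and g: "\<forall>m. mcoeff g m \<noteq> 0 \<longrightarrow> size m \<le> e" and "mcoeff (f * g) m \<noteq> 0"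
  then obtain a where a: "a \<subseteq># m" and "mcoeff f a * mcoeff g (m - a) \<noteq> 0"
    unfolding mcoeff_mult by (auto elim: sum.not_neutral_contains_not_neutral)
  then have "mcoeff f a \<noteq> 0" "mcoeff g (m - a) \<noteq> 0" by auto
  then have "size a \<le> d" "size (m - a) \<le> e" using f g by auto
  moreover have "size m = size a + size (m - a)"
    using a by (metis size_union subset_mset.add_diff_inverse)
  ultimately show "size m \<le> d + e" by simp
qed

lemma mdeg_le_mconst: "mdeg_le d (mconst c)"
  by (simp add: mdeg_le_def mconst_def)

lemma mdeg_le_0_1: "mdeg_le d 0" "mdeg_le d 1"
  by (simp_all add: mdeg_le_def mcoeff_one)

lemma mdeg_le_mvar: "mdeg_le 1 (mvar i)"
  by (simp add: mdeg_le_def mvar_def)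

lemma mdeg_le_mvar_power: "mdeg_le k (mvar i ^ k)"
proof (induction k)
  case (Suc k)
  then show ?case using mdeg_le_mult[OF mdeg_le_mvar, of k "mvar i ^ k"] by simp
qed (simp add: mdeg_le_0_1)

definition zdeg_le :: "'a::comm_ring_1 mvs fps \<Rightarrow> bool"
  where "zdeg_le F \<longleftrightarrow> (\<forall>n. mdeg_le n (fps_nth F n))"

lemma zdeg_le_mult: "zdeg_le F \<Longrightarrow> zdeg_le G \<Longrightarrow> zdeg_le (F * G)"
  unfolding zdeg_le_def fps_mult_nth
  by (intro allI mdeg_le_sum) (metis atLeastAtMost_iff le_add_diff_inverse mdeg_le_mult)

lemma zdeg_le_1: "zdeg_le 1"
  by (simp add: zdeg_le_def mdeg_le_0_1)

lemma zdeg_le_prod: "(\<And>a. a \<in> A \<Longrightarrow> zdeg_le (F a)) \<Longrightarrow> zdeg_le (prod F A)"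
  by (induction A rule: infinite_finite_induct) (auto simp: zdeg_le_1 zdeg_le_mult)

text \<open>Divisibility by the variable \<open>x\<^sub>i\<close>.\<close>
definition mdiv :: "nat \<Rightarrow> 'a::comm_ring_1 mvs \<Rightarrow> bool"
  where "mdiv i f \<longleftrightarrow> (\<forall>m. i \<notin># m \<longrightarrow> mcoeff f m = 0)"

lemma mdiv_sum: "(\<And>a. a \<in> A \<Longrightarrow> mdiv i (f a)) \<Longrightarrow> mdiv i (sum f A)"
  by (simp add: mdiv_def)

lemma mdiv_mult: "mdiv i f \<Longrightarrow> mdiv i (f * g)"
  unfolding mdiv_def mcoeff_mult
  by (intro allI impI sum.neutral) (metis mem_Collect_eq mset_subset_eqD mult_zero_left)

lemma mdiv_mvar: "mdiv i (mvar i)"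
  by (auto simp: mdiv_def mvar_def)

lemma geometric_right_inverse:
  "fps_right_inverse (1 - fps_const x * fps_X) 1 = Abs_fps (\<lambda>n. x ^ n)"
  for x :: "'a::comm_ring_1"
proof -
  let ?F = "1 - fps_const x * fps_X :: 'a fps"
  have F: "?F * fps_right_inverse ?F 1 = 1"
    by (rule fps_right_inverse) simp
  have G: "?F * Abs_fps (\<lambda>n. x ^ n) = 1"
  proof (rule fps_ext)
    fix n show "fps_nth (?F * Abs_fps (\<lambda>n. x ^ n)) n = fps_nth 1 n"
      by (cases n) (simp_all add: left_diff_distrib mult.assoc)
  qed
  have "fps_right_inverse ?F 1 = fps_right_inverse ?F 1 * (?F * Abs_fps (\<lambda>n. x ^ n))"
    by (simp only: G mult_1_right)
  also have "\<dots> = (?F * fps_right_inverse ?F 1) * Abs_fps (\<lambda>n. x ^ n)"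
    by (simp only: mult.assoc mult.left_commute)
  also have "\<dots> = Abs_fps (\<lambda>n. x ^ n)"
    by (simp only: F mult_1_left)
  finally show ?thesis .
qed

lemma q_factor_altdef:
  "q_factor i = (1 - fps_const (mvar i) * fps_mconst zbar) * Abs_fps (\<lambda>n. mvar i ^ n)"
  by (simp add: q_factor_def geometric_right_inverse)

lemma zbar_nth_0 [simp]: "fps_nth zbar 0 = 0"
  by (simp add: zbar_def fps_divide_unit)

lemma zdeg_le_q_factor: "zdeg_le (q_factor i)"
proof -
  have "mdeg_le n (mvar i * mconst (fps_nth zbar n))" for n
  proof (cases n)
    case 0
    then show ?thesis by (simp add: mdeg_le_def mult.commute[of "mvar i"])
  next
    case (Suc k)
    have "mdeg_le (1 + k) (mvar i * mconst (fps_nth zbar n))"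
      by (rule mdeg_le_mult[OF mdeg_le_mvar mdeg_le_mconst])
    then show ?thesis using Suc by simp
  qed
  then have "mdeg_le n (fps_nth 1 n - mvar i * mconst (fps_nth zbar n))" for n
    by (intro mdeg_le_diff) (simp_all add: mdeg_le_0_1)
  then have "zdeg_le (1 - fps_const (mvar i) * fps_mconst zbar)"
    by (simp only: zdeg_le_def fps_mconst_def fps_sub_nth fps_mult_left_const_nth fps_nth_Abs_fps)
      simp
  then show ?thesis unfolding q_factor_altdef
    by (rule zdeg_le_mult) (simp add: zdeg_le_def mdeg_le_mvar_power)
qed

lemma q_factor_minus_1:
  "mdiv i (fps_nth (q_factor i - 1) n)"
proof -
  let ?R = "fps_right_inverse (1 - fps_const (mvar i) * fps_X) 1 :: Qbeta mvs fps"
  have R: "(1 - fps_const (mvar i) * fps_X) * ?R = 1"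
    by (rule fps_right_inverse) simp
  have "q_factor i - 1 = q_factor i - (1 - fps_const (mvar i) * fps_X) * ?R"
    by (simp only: R)
  also have "\<dots> = fps_const (mvar i) * ((fps_X - fps_mconst zbar) * ?R)"
    unfolding q_factor_def by (simp only: algebra_simps)
  finally have "fps_nth (q_factor i - 1) n
      = mvar i * fps_nth ((fps_X - fps_mconst zbar) * ?R) n"
    by (simp only: fps_mult_left_const_nth)
  then show ?thesis by (simp only: mdiv_mult mdiv_mvar)
qed

lemma q_prod_drop:
  assumes "finite T" "S \<subseteq> T" "set_mset m \<inter> T \<subseteq> S"
  shows "mcoeff (fps_nth (\<Prod>i\<in>T. q_factor i) n) m = mcoeff (fps_nth (\<Prod>i\<in>S. q_factor i) n) m"
proof -
  have "mcoeff (fps_nth (\<Prod>i\<in>S \<union> U. q_factor i) n) m = mcoeff (fps_nth (\<Prod>i\<in>S. q_factor i) n) m"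
    if "finite U" "U \<inter> set_mset m = {}" "S \<inter> U = {}" for U
    using that
  proof (induction U)
    case (insert j U)
    let ?P = "\<Prod>i\<in>S \<union> U. q_factor i"
    have fin: "finite (S \<union> U)" using insert assms finite_subset by blast
    have "mdiv j (fps_nth ((q_factor j - 1) * ?P) n)"
      unfolding fps_mult_nth by (intro mdiv_sum mdiv_mult q_factor_minus_1)
    then have 0: "mcoeff (fps_nth ((q_factor j - 1) * ?P) n) m = 0"
      using insert.prems by (auto simp: mdiv_def)
    have "(\<Prod>i\<in>S \<union> insert j U. q_factor i) = q_factor j * ?P"
      using insert fin by (simp add: insert_absorb)
    also have "\<dots> = (q_factor j - 1) * ?P + ?P" by (simp add: algebra_simps)
    finally show ?case using insert 0 by simp
  qed simp
  from this[of "T - S"] show ?thesis using assms by (auto simp: Un_absorb1)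
qed

lemma coeffwise_lim_unique:
  assumes "coeffwise_lim F L" "coeffwise_lim F L'"
  shows "L = L'"
proof (rule fps_ext, rule mvs_eqI)
  fix n m
  have "\<forall>\<^sub>F N in sequentially. mcoeff (fps_nth L n) m = mcoeff (fps_nth L' n) m"
    using assms[unfolded coeffwise_lim_def, rule_format, of n m]
    by eventually_elim simp
  then show "mcoeff (fps_nth L n) m = mcoeff (fps_nth L' n) m" by simp
qed

lemma coeffwise_lim_q_gf: "coeffwise_lim (\<lambda>N. \<Prod>i<N. q_factor i) q_gf"
proof -
  define L :: "Qbeta mvs fps"
    where "L = Abs_fps (\<lambda>n. MVS (\<lambda>m. mcoeff (fps_nth (\<Prod>i\<in>set_mset m. q_factor i) n) m))"
  have "coeffwise_lim (\<lambda>N. \<Prod>i<N. q_factor i) L"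
    unfolding coeffwise_lim_def
  proof (intro allI)
    fix n and m :: "nat multiset"
    obtain N0 where N0: "set_mset m \<subseteq> {..<N0}"
      using finite_nat_bounded[of "set_mset m"] by auto
    show "\<forall>\<^sub>F N in sequentially.
        mcoeff (fps_nth (\<Prod>i<N. q_factor i) n) m = mcoeff (fps_nth L n) m"
      using eventually_ge_at_top[of N0]
    proof eventually_elim
      case (elim N)
      then have "set_mset m \<subseteq> {..<N}" using N0 by auto
      then show ?case by (simp add: L_def q_prod_drop[of "{..<N}" "set_mset m"])
    qed
  qed
  then have "\<exists>!L. coeffwise_lim (\<lambda>N. \<Prod>i<N. q_factor i) L"
    using coeffwise_lim_unique by blast
  then show ?thesis unfolding q_gf_def by (rule theI')
qed

lemma mcoeff_qb:
  assumes "finite S" "set_mset m \<subseteq> S"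
  shows "mcoeff (qb n) m = mcoeff (fps_nth (\<Prod>i\<in>S. q_factor i) n) m"
proof -
  have "\<forall>\<^sub>F N in sequentially. mcoeff (fps_nth (\<Prod>i<N. q_factor i) n) m = mcoeff (qb n) m"
    using coeffwise_lim_q_gf by (simp add: coeffwise_lim_def qb_def)
  moreover obtain N0 where N0: "set_mset m \<subseteq> {..<N0}"
    using finite_nat_bounded[of "set_mset m"] by auto
  ultimately obtain N where N: "N \<ge> N0"
    "mcoeff (fps_nth (\<Prod>i<N. q_factor i) n) m = mcoeff (qb n) m"
    unfolding eventually_sequentially by (meson nle_le)
  have "set_mset m \<subseteq> {..<N}" using N N0 by auto
  then show ?thesis
    using N(2) q_prod_drop[of "{..<N}" "set_mset m" m n] q_prod_drop[of S "set_mset m" m n] assms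
    by simp
qed

lemma mdeg_le_qb: "mdeg_le n (qb n)"
proof -
  have "zdeg_le (\<Prod>i\<in>set_mset m. q_factor i)" for m :: "nat multiset"
    by (intro zdeg_le_prod zdeg_le_q_factor)
  then show ?thesis
    unfolding mdeg_le_def zdeg_le_def using mcoeff_qb[OF finite_set_mset subset_refl] by metis
qed

text \<open>The action of a permutation of the variables.\<close>
definition mperm :: "(nat \<Rightarrow> nat) \<Rightarrow> 'a mvs \<Rightarrow> 'a mvs"
  where "mperm \<pi> f = MVS (\<lambda>m. mcoeff f (image_mset \<pi> m))"

definition fperm :: "(nat \<Rightarrow> nat) \<Rightarrow> 'a::comm_ring_1 mvs fps \<Rightarrow> 'a mvs fps"
  where "fperm \<pi> F = Abs_fps (\<lambda>n. mperm \<pi> (fps_nth F n))"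

lemma symmetric_iff_mperm: "symmetric f \<longleftrightarrow> (\<forall>\<pi>. bij \<pi> \<longrightarrow> mperm \<pi> f = f)"
  unfolding symmetric_def mperm_def by (metis mcoeff_MVS mvs_eqI)

lemma mperm_add: "mperm \<pi> (f + g) = mperm \<pi> f + mperm \<pi> g"
  and mperm_diff: "mperm \<pi> (f - g) = mperm \<pi> f - mperm \<pi> g"
  and mperm_0: "mperm \<pi> (0 :: 'a::comm_ring_1 mvs) = 0"
  and mperm_1: "mperm \<pi> (1 :: 'a::comm_ring_1 mvs) = 1"
  and mperm_mconst: "mperm \<pi> (mconst c) = mconst c"
  by (auto intro!: mvs_eqI simp: mperm_def mconst_def mcoeff_one)

lemma mperm_sum: "mperm \<pi> (sum f A) = (\<Sum>a\<in>A. mperm \<pi> (f a))"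
  by (induction A rule: infinite_finite_induct) (auto simp: mperm_0 mperm_add)

context
  fixes \<pi> :: "nat \<Rightarrow> nat"
  assumes bij: "bij \<pi>"
begin

lemma image_mset_inv_cancel:
  "image_mset (inv \<pi>) (image_mset \<pi> m) = m" "image_mset \<pi> (image_mset (inv \<pi>) m) = m"
  using bij by (simp_all add: image_mset.compositionality comp_def bij_is_inj
      bij_is_surj surj_f_inv_f)

lemma mperm_mult: "mperm \<pi> (f * g) = mperm \<pi> f * mperm \<pi> g"
proof (rule mvs_eqI)
  fix m
  have "(\<Sum>a\<in>{a. a \<subseteq># image_mset \<pi> m}. mcoeff f a * mcoeff g (image_mset \<pi> m - a))
    = (\<Sum>a\<in>{a. a \<subseteq># m}. mcoeff f (image_mset \<pi> a) * mcoeff g (image_mset \<pi> (m - a)))"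
  proof (rule sum.reindex_bij_witness[of _ "image_mset \<pi>" "image_mset (inv \<pi>)"])
    fix a assume "a \<in> {a. a \<subseteq># image_mset \<pi> m}"
    then have a: "image_mset (inv \<pi>) a \<subseteq># m"
      by (metis image_mset_inv_cancel(1) image_mset_subseteq_mono mem_Collect_eq)
    then show "image_mset (inv \<pi>) a \<in> {a. a \<subseteq># m}" by simp
    show "mcoeff f (image_mset \<pi> (image_mset (inv \<pi>) a))
        * mcoeff g (image_mset \<pi> (m - image_mset (inv \<pi>) a))
      = mcoeff f a * mcoeff g (image_mset \<pi> m - a)"
      using a by (simp only: image_mset_Diff image_mset_inv_cancel)
  qed (simp_all add: image_mset_inv_cancel image_mset_subseteq_mono)
  then show "mcoeff (mperm \<pi> (f * g)) m = mcoeff (mperm \<pi> f * mperm \<pi> g) m"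
    by (simp add: mperm_def mcoeff_mult)
qed

lemma mperm_mvar: "mperm \<pi> (mvar i) = mvar (inv \<pi> i)"
proof (rule mvs_eqI)
  fix m
  have "image_mset \<pi> m = {#i#} \<longleftrightarrow> m = {#inv \<pi> i#}"
    by (metis image_mset_inv_cancel image_mset_single)
  then show "mcoeff (mperm \<pi> (mvar i)) m = mcoeff (mvar (inv \<pi> i)) m"
    by (simp add: mperm_def mvar_def)
qed

lemma mperm_power: "mperm \<pi> (f ^ n) = mperm \<pi> f ^ n"
  by (induction n) (auto simp: mperm_1 mperm_mult)

lemma fperm_mult: "fperm \<pi> (F * G) = fperm \<pi> F * fperm \<pi> G"
  by (rule fps_ext) (simp add: fperm_def fps_mult_nth mperm_sum mperm_mult)

lemma fperm_1: "fperm \<pi> 1 = 1"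
  by (rule fps_ext) (simp add: fperm_def mperm_0 mperm_1)

lemma fperm_prod: "fperm \<pi> (prod F A) = (\<Prod>a\<in>A. fperm \<pi> (F a))"
  by (induction A rule: infinite_finite_induct) (auto simp: fperm_1 fperm_mult)

lemma fperm_q_factor: "fperm \<pi> (q_factor i) = q_factor (inv \<pi> i)"
proof -
  have "fperm \<pi> (1 - fps_const (mvar i) * fps_mconst zbar)
      = 1 - fps_const (mvar (inv \<pi> i)) * fps_mconst zbar"
    by (rule fps_ext) (simp add: fperm_def fps_mconst_def mperm_diff mperm_mult mperm_mvar
        mperm_mconst mperm_0 mperm_1)
  moreover have "fperm \<pi> (Abs_fps (\<lambda>n. mvar i ^ n)) 
      = (Abs_fps (\<lambda>n. mvar (inv \<pi> i) ^ n) :: Qbeta mvs fps)"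
    by (rule fps_ext) (simp add: fperm_def mperm_power mperm_mvar)
  ultimately show ?thesis by (simp only: q_factor_altdef fperm_mult)
qed

lemma mcoeff_qb_perm: "mcoeff (qb n) (image_mset \<pi> m) = mcoeff (qb n) m"
proof -
  have "mcoeff (qb n) (image_mset \<pi> m)
      = mcoeff (fps_nth (fperm \<pi> (\<Prod>i\<in>\<pi> ` set_mset m. q_factor i)) n) m"
    by (simp add: mcoeff_qb[of "\<pi> ` set_mset m"] fperm_def mperm_def)
  also have "fperm \<pi> (\<Prod>i\<in>\<pi> ` set_mset m. q_factor i) = (\<Prod>i\<in>set_mset m. q_factor i)"
    unfolding fperm_prod fperm_q_factor
    using bij by (subst prod.reindex)
      (auto simp: bij_is_inj comp_def intro: inj_on_subset[OF bij_is_inj])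
  finally show ?thesis by (simp add: mcoeff_qb[of "set_mset m"])
qed

end

lemma bounded_degree_iff: "bounded_degree f \<longleftrightarrow> (\<exists>d. mdeg_le d f)"
  by (simp add: bounded_degree_def mdeg_le_def)

lemma qb_in_Lam: "qb n \<in> Lam"
  using mdeg_le_qb mcoeff_qb_perm by (auto simp: Lam_def symmetric_def bounded_degree_iff)

lemma Lam_mconst: "mconst c \<in> Lam"
  by (auto simp: Lam_def symmetric_iff_mperm mperm_mconst bounded_degree_iff mdeg_le_mconst)

lemma Lam_1: "1 \<in> Lam"
  by (auto simp: Lam_def symmetric_iff_mperm mperm_1 bounded_degree_iff mdeg_le_0_1)

lemma Lam_0: "0 \<in> Lam"
  by (auto simp: Lam_def symmetric_iff_mperm mperm_0 bounded_degree_iff mdeg_le_0_1)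

lemma Lam_add:
  assumes "f \<in> Lam" "g \<in> Lam"
  shows "f + g \<in> Lam"
proof -
  obtain d e where "mdeg_le d f" "mdeg_le e g" using assms by (auto simp: Lam_def bounded_degree_iff)
  then have "mdeg_le (max d e) (f + g)" by (intro mdeg_le_add) (auto elim: mdeg_le_mono)
  then show ?thesis using assms
    by (auto simp: Lam_def symmetric_iff_mperm mperm_add bounded_degree_iff)
qed

lemma Lam_mult: "f \<in> Lam \<Longrightarrow> g \<in> Lam \<Longrightarrow> f * g \<in> Lam"
  unfolding Lam_def symmetric_iff_mperm bounded_degree_iff
  by (auto simp: mperm_mult intro: mdeg_le_mult)

lemma Zbeta_subalgebra_Lam: "Zbeta_subalgebra Lam"
  by (simp add: Zbeta_subalgebra_def Lam_1 Lam_add Lam_mult Lam_mconst)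

lemma Lam_sum: "(\<And>a. a \<in> A \<Longrightarrow> f a \<in> Lam) \<Longrightarrow> sum f A \<in> Lam"
  by (induction A rule: infinite_finite_induct) (auto simp: Lam_0 Lam_add)

lemma gp_in_Lam: "gp n \<in> Lam"
  unfolding gp_def gp_gf_def fps_mult_nth
  by (intro Lam_sum Lam_mult) (simp_all add: fps_mconst_def Lam_mconst Lam_0 qb_in_Lam)

lemma Zbeta_subalgebra_adjoin:
  assumes "S \<subseteq> Lam"
  shows "Zbeta_subalgebra (Zbeta_adjoin S)"
proof -
  have "Zbeta_adjoin S \<subseteq> Lam"
    unfolding Zbeta_adjoin_def using assms Zbeta_subalgebra_Lam by (rule hull_minimal)
  moreover have "1 \<in> Zbeta_adjoin S"
    unfolding Zbeta_adjoin_def hull_def by (auto simp: Zbeta_subalgebra_def)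
  moreover have "f + g \<in> Zbeta_adjoin S" "f * g \<in> Zbeta_adjoin S"
    if "f \<in> Zbeta_adjoin S" "g \<in> Zbeta_adjoin S" for f g
    using that unfolding Zbeta_adjoin_def hull_def by (auto simp: Zbeta_subalgebra_def)
  moreover have "mconst c * f \<in> Zbeta_adjoin S" if "f \<in> Zbeta_adjoin S" "c \<in> Zbeta" for f c
    using that unfolding Zbeta_adjoin_def hull_def by (auto simp: Zbeta_subalgebra_def)
  ultimately show ?thesis
    unfolding Zbeta_subalgebra_def by blast
qed

end

theory Submission
  imports Defs
begin

text \<open>
  Write \<open>Q(z) = 1 + (2 + \<beta> z) G(z)\<close> with \<open>G\<close> the generating function of the \<open>gp\<^sub>n\<close>. Since
  \<open>Q(z) Q(zbar) = 1\<close>, cancelling \<open>2 + \<beta> z\<close> gives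
  \<open>(1 + \<beta> z) G(z) + G(zbar) + (2 + \<beta> z) G(z) G(zbar) = 0\<close>. This does not solve integrally for the
  even coefficients, because they occur with a factor \<open>2\<close>. However, \<open>t = z\<^sup>2 / (1 + \<beta> z) = -z zbar\<close>
  is invariant under \<open>z \<mapsto> zbar\<close> and every power series is uniquely \<open>A(t) + z B(t)\<close>. For
  \<open>G = A(t) + z B(t)\<close> the relation is divisible by \<open>(1 + \<beta> z) (2 + \<beta> z)\<close>, and the quotient is
  \<open>A + \<beta> t B + A\<^sup>2 + \<beta> t A B - t B\<^sup>2 = 0\<close>. It expresses each coefficient of \<open>A\<close> integrally by earlier
  coefficients of \<open>A\<close> and \<open>B\<close>, while the \<open>n\<close>-th coefficient of \<open>B\<close> is \<open>gp\<^bsub>2n+1\<^esub>\<close> up to a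
  \<open>\<int>[\<beta>]\<close>-combination of coefficients of \<open>A\<close> up to index \<open>n\<close> and of \<open>B\<close> below index \<open>n\<close>.
\<close>

text \<open>Serves where cancellation in an integral domain would be usual: \<open>mvs\<close> is
  only known as a \<open>comm_ring_1\<close>, so \<open>1 + b X\<close> and \<open>2 + b X\<close>
  are cancelled as units.\<close>

lemma unit_cancel:
  fixes a :: "'a::comm_ring_1"
  assumes "a * r = 1" "a * x = a * y"
  shows "x = y"
  using assms by (metis mult.assoc mult.commute mult_1_left)

section \<open>Composition of power series over a commutative ring\<close>

lemma fps_power_nth_zero:
  fixes c :: "'a::comm_ring_1 fps"
  assumes "fps_nth c 0 = 0" "n < k"
  shows "fps_nth (c ^ k) n = 0"
proof -
  have "c = fps_X * fps_shift 1 c"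
    using assms(1) by (intro fps_ext) auto
  then have "c ^ k = fps_X ^ k * fps_shift 1 c ^ k"
    by (metis power_mult_distrib)
  then show ?thesis using assms(2) by (simp add: fps_X_power_mult_nth)
qed

text \<open>The library has this only over integral domains.\<close>
lemma fps_compose_mult:
  fixes c :: "'a::comm_ring_1 fps"
  assumes c0: "fps_nth c 0 = 0"
  shows "(F * G) oo c = (F oo c) * (G oo c)"
proof (rule fps_ext)
  fix n
  define h where "h i j = fps_nth F i * fps_nth G j * fps_nth (c ^ (i + j)) n" for i j
  have h0: "h i j = 0" if "n < i + j" for i j
    using that by (simp add: h_def fps_power_nth_zero[OF c0])
  \<comment> \<open>Since \<open>c ^ i\<close> has order at least \<open>i\<close>, the range may be
    extended to \<open>n\<close> independently of \<open>k\<close>; the sums can then be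
    interchanged.\<close>
  have compose: "fps_nth (H oo c) k = (\<Sum>i\<le>n. fps_nth H i * fps_nth (c ^ i) k)"
    if "k \<le> n" for H k
    unfolding fps_compose_nth atLeast0AtMost
    using that by (intro sum.mono_neutral_left) (auto simp: fps_power_nth_zero[OF c0])
  have "fps_nth ((F oo c) * (G oo c)) n
      = (\<Sum>k\<le>n. \<Sum>i\<le>n. \<Sum>j\<le>n. fps_nth F i * fps_nth G j
          * (fps_nth (c ^ i) k * fps_nth (c ^ j) (n - k)))"
    by (simp add: fps_mult_nth atLeast0AtMost compose sum_product mult_ac)
  also have "\<dots> = (\<Sum>i\<le>n. \<Sum>k\<le>n. \<Sum>j\<le>n. fps_nth F i * fps_nth G j
          * (fps_nth (c ^ i) k * fps_nth (c ^ j) (n - k)))"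
    by (rule sum.swap)
  also have "\<dots> = (\<Sum>i\<le>n. \<Sum>j\<le>n. \<Sum>k\<le>n. fps_nth F i * fps_nth G j
          * (fps_nth (c ^ i) k * fps_nth (c ^ j) (n - k)))"
    by (intro sum.cong refl sum.swap)
  also have "\<dots> = (\<Sum>i\<le>n. \<Sum>j\<le>n. h i j)"
    by (simp only: h_def power_add fps_mult_nth atLeast0AtMost sum_distrib_left)
  also have "\<dots> = (\<Sum>i\<le>n. \<Sum>j\<le>n - i. h i j)"
    by (rule sum.cong[OF refl], rule sum.mono_neutral_right) (auto intro!: h0)
  also have "\<dots> = (\<Sum>(i, j)\<in>Sigma {..n} (\<lambda>i. {..n - i}). h i j)"
    by (rule sum.Sigma) auto
  also have "\<dots> = (\<Sum>(k, i)\<in>Sigma {..n} (\<lambda>k. {..k}). h i (k - i))"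
    by (rule sum.reindex_bij_witness[of _ "\<lambda>(k, i). (i, k - i)" "\<lambda>(i, j). (i + j, i)"]) auto
  also have "\<dots> = (\<Sum>k\<le>n. \<Sum>i\<le>k. h i (k - i))"
    by (rule sum.Sigma[symmetric]) auto
  also have "\<dots> = fps_nth ((F * G) oo c) n"
    by (simp add: h_def fps_compose_nth fps_mult_nth atLeast0AtMost sum_distrib_right)
  finally show "fps_nth ((F * G) oo c) n = fps_nth ((F oo c) * (G oo c)) n" by simp
qed

lemma fps_compose_prod:
  fixes c :: "'a::comm_ring_1 fps"
  assumes "fps_nth c 0 = 0"
  shows "prod F S oo c = (\<Prod>i\<in>S. F i oo c)"
  by (induction S rule: infinite_finite_induct) (auto simp: fps_compose_mult[OF assms])

lemma fps_eq_const_plus_shift: "F = fps_const (fps_nth F 0) + fps_X * fps_shift 1 F"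
  for F :: "'a::comm_ring_1 fps"
  by (rule fps_ext) auto

text \<open>One Horner step, the basis of the recursive arguments about substituting
  \<open>t\<close>.\<close>

lemma fps_compose_shift:
  fixes c :: "'a::comm_ring_1 fps"
  assumes "fps_nth c 0 = 0"
  shows "F oo c = fps_const (fps_nth F 0) + c * (fps_shift 1 F oo c)"
  by (subst fps_eq_const_plus_shift[of F])
    (simp only: fps_compose_add_distrib fps_const_compose fps_compose_mult[OF assms]
      fps_X_fps_compose_startby0[OF assms])

text \<open>Iterating the equation makes \<open>D x\<close> divisible by every power of
  \<open>T\<close>. It is applied to differences of two series that obey the same recursion.\<close>

lemma fps_zero_if_divisible:
  fixes T :: "'a::comm_ring_1 fps"
  assumes D: "\<And>x. D x = T * D (s x)" and T0: "fps_nth T 0 = 0"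
  shows "D x = 0"
proof -
  have "fps_nth (D x) n = 0" for n
  proof (induction n arbitrary: x rule: less_induct)
    case (less n)
    have "fps_nth T i * fps_nth (D (s x)) (n - i) = 0" if "i \<le> n" for i
      using less[of "n - i" "s x"] that T0 by (cases "i = 0") auto
    then show ?case by (subst D) (simp add: fps_mult_nth)
  qed
  then show ?thesis by (simp add: fps_eq_iff)
qed


section \<open>The involution and its invariant\<close>

text \<open>The inverse of \<open>1 + b z\<close>, written out so that it makes sense without
  division in the coefficient ring.\<close>

definition fps_geom :: "'a::comm_ring_1 \<Rightarrow> 'a fps"
  where "fps_geom b = Abs_fps (\<lambda>n. (- b) ^ n)"

text \<open>This is zbar, with \<open>b\<close> for beta in any commutative ring.\<close>

definition invol_var :: "'a::comm_ring_1 \<Rightarrow> 'a fps"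
  where "invol_var b = - fps_X * fps_geom b"

text \<open>The invariant \<open>t\<close> of the overview.\<close>

definition invar_var :: "'a::comm_ring_1 \<Rightarrow> 'a fps"
  where "invar_var b = fps_X ^ 2 * fps_geom b"

lemma fps_geom_inverse: "(1 + fps_const b * fps_X) * fps_geom b = 1"
proof (rule fps_ext)
  fix n show "fps_nth ((1 + fps_const b * fps_X) * fps_geom b) n = fps_nth 1 n"
    by (cases n) (simp_all add: fps_geom_def distrib_right mult.assoc)
qed

lemma fps_geom_inverse': "fps_geom b * (1 + fps_const b * fps_X) = 1"
  using fps_geom_inverse[of b] by (simp only: mult.commute)

lemma invol_var_nth_0 [simp]: "fps_nth (invol_var b) 0 = 0"
  by (simp add: invol_var_def)

lemma invar_var_nth_0 [simp]: "fps_nth (invar_var b) 0 = 0"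
  by (simp add: invar_var_def)

lemma invol_var_mult: "(1 + fps_const b * fps_X) * invol_var b = - fps_X"
  unfolding invol_var_def
  by (simp only: mult.left_commute[of _ "- fps_X"] fps_geom_inverse mult_1_right)

lemma invar_var_mult: "(1 + fps_const b * fps_X) * invar_var b = fps_X ^ 2"
  unfolding invar_var_def
  by (simp only: mult.left_commute[of _ "fps_X ^ 2"] fps_geom_inverse mult_1_right)

lemma invar_var_eq: "invar_var b = - fps_X * invol_var b"
  by (simp add: invar_var_def invol_var_def power2_eq_square mult.assoc)

lemma invol_var_unit: "1 + fps_const b * invol_var b = fps_geom b"
  using fps_geom_inverse[of b] by (simp add: invol_var_def algebra_simps)

text \<open>Substitute zbar into \<open>(1 + b z) zbar = - z\<close>. As \<open>1 + b zbar\<close>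
  is the inverse of \<open>1 + b z\<close>, both sides carry this unit.\<close>

lemma invol_var_compose: "invol_var b oo invol_var b = fps_X"
proof -
  let ?W = "invol_var b" and ?V = "fps_geom b"
  have "((1 + fps_const b * fps_X) * ?W) oo ?W = (- fps_X) oo ?W"
    by (simp only: invol_var_mult)
  then have "(1 + fps_const b * ?W) * (?W oo ?W) = - ?W"
    by (simp only: fps_compose_mult[OF invol_var_nth_0] fps_compose_add_distrib fps_compose_1
        fps_const_compose fps_X_fps_compose_startby0[OF invol_var_nth_0] fps_compose_uminus)
  then have "?V * (?W oo ?W) = ?V * fps_X"
    by (simp only: invol_var_unit) (simp add: invol_var_def mult.commute)
  then show ?thesis by (rule unit_cancel[OF fps_geom_inverse'])
qed

lemma invar_var_compose: "invar_var b oo invol_var b = invar_var b"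
  unfolding invar_var_eq
  by (simp only: fps_compose_mult[OF invol_var_nth_0] fps_compose_uminus invol_var_compose
      fps_X_fps_compose_startby0[OF invol_var_nth_0]) simp

text \<open>Because \<open>t\<close> itself is invariant, a Horner step on both sides shows that
  their difference is \<open>t\<close> times the difference for the shifted series.\<close>

lemma compose_invar_var_invariant: "(F oo invar_var b) oo invol_var b = F oo invar_var b"
proof -
  let ?T = "invar_var b" and ?W = "invol_var b"
  define D where "D F = ((F oo ?T) oo ?W) - (F oo ?T)" for F
  have "D F = ?T * D (fps_shift 1 F)" for F
  proof -
    have "(F oo ?T) oo ?W = fps_const (fps_nth F 0) + ?T * ((fps_shift 1 F oo ?T) oo ?W)"
      by (subst fps_compose_shift[OF invar_var_nth_0])
        (simp only: fps_compose_add_distrib fps_const_compose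
          fps_compose_mult[OF invol_var_nth_0] invar_var_compose)
    moreover have "F oo ?T = fps_const (fps_nth F 0) + ?T * (fps_shift 1 F oo ?T)"
      by (rule fps_compose_shift) simp
    ultimately have "D F = (fps_const (fps_nth F 0) + ?T * ((fps_shift 1 F oo ?T) oo ?W))
        - (fps_const (fps_nth F 0) + ?T * (fps_shift 1 F oo ?T))"
      unfolding D_def by (rule arg_cong2[where f = minus])
    then show ?thesis by (simp add: D_def right_diff_distrib)
  qed
  then have "D F = 0"
    by (rule fps_zero_if_divisible) simp
  then show ?thesis by (simp add: D_def)
qed

text \<open>Injectivity of substituting \<open>t\<close>: the constant term vanishes, and
  multiplying by \<open>1 + b z\<close> turns the remaining factor \<open>t\<close> into
  \<open>z^2\<close>, which cancels. Repeating this reaches every coefficient.\<close>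

lemma compose_invar_var_eq_0:
  assumes "F oo invar_var b = 0"
  shows "F = 0"
proof -
  have "fps_nth F n = 0" if "F oo invar_var b = 0" for n F
    using that
  proof (induction n arbitrary: F)
    case 0
    then show ?case by (metis fps_compose_nth_0 fps_zero_nth)
  next
    case (Suc n)
    have "fps_nth F 0 = 0" using Suc.prems by (metis fps_compose_nth_0 fps_zero_nth)
    then have "invar_var b * (fps_shift 1 F oo invar_var b) = 0"
      using Suc.prems fps_compose_shift[OF invar_var_nth_0, of F b] by simp
    then have "fps_X ^ 2 * (fps_shift 1 F oo invar_var b) = 0"
      unfolding invar_var_mult[symmetric, of b] by (simp only: mult.assoc mult_zero_right)
    then have "fps_nth (fps_X ^ 2 * (fps_shift 1 F oo invar_var b)) (k + 2) = 0" for k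
      by (simp only: fps_zero_nth)
    then have "fps_shift 1 F oo invar_var b = 0"
      by (intro fps_ext) (simp add: fps_X_power_mult_nth)
    then show ?case using Suc.IH[of "fps_shift 1 F"] by simp
  qed
  then show ?thesis using assms by (simp add: fps_eq_iff)
qed

lemma invar_var_power_nth:
  "fps_nth (invar_var b ^ i) n = (if n < 2 * i then 0 else fps_nth (fps_geom b ^ i) (n - 2 * i))"
  by (simp add: invar_var_def power_mult_distrib fps_X_power_mult_nth flip: power_mult)

lemma ex_invar_var_decomposition:
  fixes F :: "'a::comm_ring_1 fps"
  shows "\<exists>A B. F = (A oo invar_var b) + fps_X * (B oo invar_var b)"
proof -
  let ?T = "invar_var b" and ?u = "1 + fps_const b * fps_X :: 'a fps"
  \<comment> \<open>From \<open>z^2 = (1 + b z) t\<close> follows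
    \<open>F = F_0 + F_1 z + t * s F\<close>; iterating \<open>s\<close> yields the coefficients of
    \<open>A\<close> and \<open>B\<close> one pair at a time.\<close>
  define s where "s F = ?u * fps_shift 2 F" for F
  define A where "A F = Abs_fps (\<lambda>k. fps_nth ((s ^^ k) F) 0)" for F
  define B where "B F = Abs_fps (\<lambda>k. fps_nth ((s ^^ k) F) 1)" for F
  define D where "D F = F - (A F oo ?T) - fps_X * (B F oo ?T)" for F
  have "D F = ?T * D (s F)" for F
  proof -
    have "fps_shift 1 (A F) = A (s F)" "fps_shift 1 (B F) = B (s F)"
      by (rule fps_ext, simp add: A_def B_def funpow_swap1)+
    moreover have "fps_nth (A F) 0 = fps_nth F 0" "fps_nth (B F) 0 = fps_nth F 1"
      by (simp_all add: A_def B_def)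
    ultimately have A: "A F oo ?T = fps_const (fps_nth F 0) + ?T * (A (s F) oo ?T)"
      and B: "B F oo ?T = fps_const (fps_nth F 1) + ?T * (B (s F) oo ?T)"
      using fps_compose_shift[OF invar_var_nth_0, of "A F" b]
        fps_compose_shift[OF invar_var_nth_0, of "B F" b] by simp_all
    have F: "F = fps_const (fps_nth F 0) + fps_X * fps_const (fps_nth F 1)
        + fps_X ^ 2 * fps_shift 2 F"
    proof (rule fps_ext)
      fix n
      show "fps_nth F n = fps_nth (fps_const (fps_nth F 0) + fps_X * fps_const (fps_nth F 1)
          + fps_X ^ 2 * fps_shift 2 F) n"
        by (cases "n < 2")
          (auto simp: less_2_cases_iff fps_X_power_mult_nth intro!: arg_cong[where f = "fps_nth F"])
    qed
    have "D F = (fps_const (fps_nth F 0) + fps_X * fps_const (fps_nth F 1)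
        + (?u * ?T) * fps_shift 2 F) - (fps_const (fps_nth F 0) + ?T * (A (s F) oo ?T))
        - fps_X * (fps_const (fps_nth F 1) + ?T * (B (s F) oo ?T))"
      unfolding D_def invar_var_mult
      by (intro arg_cong2[where f = minus] arg_cong2[where f = times] refl F A B)
    also have "\<dots> = ?T * (?u * fps_shift 2 F - (A (s F) oo ?T) - fps_X * (B (s F) oo ?T))"
    proof -
      have "(c + x * d + (u * t) * f) - (c + t * p) - x * (d + t * q) = t * (u * f - p - x * q)"
        for c d f p q t u x :: "'a fps"
        by (simp add: algebra_simps)
      then show ?thesis .
    qed
    finally show ?thesis by (simp only: D_def s_def)
  qed
  then have "D F = 0"
    by (rule fps_zero_if_divisible) simp
  then have "F = (A F oo ?T) + fps_X * (B F oo ?T)"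
    by (simp add: D_def algebra_simps)
  then show ?thesis by blast
qed


section \<open>Odd coefficients generate all coefficients\<close>

text \<open>Here \<open>p\<close>, \<open>q\<close>, \<open>w\<close> stand for \<open>A(t)\<close>,
  \<open>B(t)\<close>, zbar. With the extra factor \<open>1 + b x\<close>, both \<open>w\<close> and
  \<open>t\<close> occur only in products that \<open>w\<close> and \<open>t\<close> of the
  assumptions turn into polynomials in \<open>x\<close>.\<close>

lemma decomposition_identity:
  fixes b x t w p q :: "'a::comm_ring_1"
  assumes w: "(1 + b * x) * w = - x" and t: "(1 + b * x) * t = x ^ 2"
  shows "(2 + b * x) * ((1 + b * x) * (p + b * t * q + p * p + b * t * p * q - t * q * q))
      = (1 + b * x) * ((1 + b * x) * (p + x * q) + (p + w * q)
        + (2 + b * x) * (p + x * q) * (p + w * q))"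
proof -
  have *: "(1 + b * x) * (p + b * t * q + p * p + b * t * p * q - t * q * q)
      = (1 + b * x) * (p + p * p) + ((1 + b * x) * t) * (b * q + b * p * q - q * q)"
    by (simp add: algebra_simps)
  have **: "u * (u * g + (p + w * q) + v * g * (p + w * q))
      = u * (u * g) + (u * p + (u * w) * q) + v * g * (u * p + (u * w) * q)" for u v g
    by (simp add: algebra_simps)
  show ?thesis
    unfolding * ** w t by (simp add: algebra_simps power2_eq_square)
qed

text \<open>In the conclusion \<open>fps_X\<close> stands for the invariant \<open>t\<close>.\<close>
lemma decomposition_relation:
  fixes A B G :: "'a::comm_ring_1 fps"
  assumes rel: "(1 + fps_const b * fps_X) * G + (G oo invol_var b)
      + (2 + fps_const b * fps_X) * G * (G oo invol_var b) = 0"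
    and unit: "(2 + fps_const b * fps_X) * R = 1"
    and G: "G = (A oo invar_var b) + fps_X * (B oo invar_var b)"
  shows "A + fps_const b * fps_X * B + A * A + fps_const b * fps_X * A * B - fps_X * B * B = 0"
proof -
  let ?T = "invar_var b" and ?W = "invol_var b" and ?u = "1 + fps_const b * fps_X :: 'a fps"
  define p q where "p = A oo ?T" and "q = B oo ?T"
  have Gp: "G = p + fps_X * q" by (simp add: G p_def q_def)
  have GW: "G oo ?W = p + ?W * q"
    by (simp only: G p_def q_def fps_compose_add_distrib fps_compose_mult[OF invol_var_nth_0]
        compose_invar_var_invariant fps_X_fps_compose_startby0[OF invol_var_nth_0])
  let ?K = "p + fps_const b * ?T * q + p * p + fps_const b * ?T * p * q - ?T * q * q"
  have "(2 + fps_const b * fps_X) * (?u * ?K)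
      = ?u * (?u * G + (G oo ?W) + (2 + fps_const b * fps_X) * G * (G oo ?W))"
    unfolding GW unfolding Gp by (rule decomposition_identity[OF invol_var_mult invar_var_mult])
  also have "\<dots> = (2 + fps_const b * fps_X) * (?u * 0)" by (simp add: rel)
  finally have "?K = 0"
    by (rule unit_cancel[OF unit, THEN unit_cancel[OF fps_geom_inverse]])
  \<comment> \<open>\<open>?K\<close> is the claimed expression with \<open>t\<close> substituted
    for the variable, and this substitution is injective.\<close>
  then have "(A + fps_const b * fps_X * B + A * A + fps_const b * fps_X * A * B - fps_X * B * B)
      oo ?T = 0"
    by (simp only: p_def q_def fps_compose_add_distrib fps_compose_sub_distrib
        fps_compose_mult[OF invar_var_nth_0] fps_const_compose
        fps_X_fps_compose_startby0[OF invar_var_nth_0])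
  then show ?thesis by (rule compose_invar_var_eq_0)
qed

section \<open>Recursion for coefficients in a subring\<close>

context
  fixes S :: "'a::comm_ring_1 set"
  assumes S_1: "1 \<in> S"
    and S_diff: "\<And>x y. x \<in> S \<Longrightarrow> y \<in> S \<Longrightarrow> x - y \<in> S"
    and S_mult: "\<And>x y. x \<in> S \<Longrightarrow> y \<in> S \<Longrightarrow> x * y \<in> S"
begin

lemma subring_0: "0 \<in> S"
  using S_diff[OF S_1 S_1] by simp

lemma subring_uminus: "x \<in> S \<Longrightarrow> - x \<in> S"
  using S_diff[OF subring_0] by simp

lemma subring_add: "x \<in> S \<Longrightarrow> y \<in> S \<Longrightarrow> x + y \<in> S"
  using S_diff[of x "- y"] subring_uminus by simp

lemma subring_sum: "(\<And>i. i \<in> I \<Longrightarrow> f i \<in> S) \<Longrightarrow> sum f I \<in> S"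
  by (induction I rule: infinite_finite_induct) (auto simp: subring_0 subring_add)

lemma subring_power: "x \<in> S \<Longrightarrow> x ^ n \<in> S"
  by (induction n) (auto simp: S_1 S_mult)

lemma subring_fps_mult_nth:
  "(\<And>i. i \<le> n \<Longrightarrow> fps_nth F i \<in> S) \<Longrightarrow> (\<And>i. i \<le> n \<Longrightarrow> fps_nth H i \<in> S) \<Longrightarrow> fps_nth (F * H) n \<in> S"
  unfolding fps_mult_nth by (intro subring_sum S_mult) auto

lemma subring_fps_power_nth:
  "(\<And>i. fps_nth F i \<in> S) \<Longrightarrow> fps_nth (F ^ k) n \<in> S"
proof (induction k arbitrary: n)
  case 0
  then show ?case by (simp add: S_1 subring_0)
next
  case (Suc k)
  then show ?case unfolding power_Suc by (intro subring_fps_mult_nth) auto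
qed

lemma subring_invar_var_power_nth: "b \<in> S \<Longrightarrow> fps_nth (invar_var b ^ i) n \<in> S"
  unfolding invar_var_power_nth
  by (auto intro!: subring_0 subring_fps_power_nth simp: fps_geom_def subring_power subring_uminus)

lemma subring_compose_invar_var_nth:
  assumes "b \<in> S" "\<And>i. 2 * i \<le> n \<Longrightarrow> fps_nth F i \<in> S"
  shows "fps_nth (F oo invar_var b) n \<in> S"
  unfolding fps_compose_nth
proof (rule subring_sum)
  fix i
  show "fps_nth F i * fps_nth (invar_var b ^ i) n \<in> S"
  proof (cases "2 * i \<le> n")
    case True
    then show ?thesis using assms by (intro S_mult subring_invar_var_power_nth)
  next
    case False
    then show ?thesis by (simp add: invar_var_power_nth subring_0)
  qed
qed

text \<open>Strong induction on the coefficients of \<open>A\<close> and \<open>B\<close> together.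
  The coefficients of \<open>R\<close> may lie outside \<open>S\<close>: \<open>R\<close> only
  justifies cancelling \<open>2 + b X\<close>, and the recursion itself never divides.\<close>

lemma subring_coeffs_if_relation:
  assumes "b \<in> S"
    and G0: "fps_nth G 0 = 0"
    and rel: "(1 + fps_const b * fps_X) * G + (G oo invol_var b)
      + (2 + fps_const b * fps_X) * G * (G oo invol_var b) = 0"
    and unit: "(2 + fps_const b * fps_X) * R = 1"
    and odd: "\<And>n. odd n \<Longrightarrow> fps_nth G n \<in> S"
  shows "fps_nth G n \<in> S"
proof -
  let ?T = "invar_var b"
  obtain A B where G: "G = (A oo ?T) + fps_X * (B oo ?T)"
    using ex_invar_var_decomposition by blast
  \<comment> \<open>The relation solved for \<open>A\<close>: the first term looks back by one index
    because of the factor \<open>fps_X\<close>, and in \<open>A * A\<close> the current coefficient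
    meets only \<open>A_0 = 0\<close>.\<close>
  have A: "A = fps_X * (B * B - fps_const b * (B + A * B)) - A * A"
  proof -
    have "A - (fps_X * (B * B - fps_const b * (B + A * B)) - A * A)
        = A + fps_const b * fps_X * B + A * A + fps_const b * fps_X * A * B - fps_X * B * B"
      by (simp add: algebra_simps)
    then show ?thesis by (simp only: decomposition_relation[OF rel unit G] right_minus_eq)
  qed
  have "fps_nth A 0 = fps_nth G 0" by (simp add: G)
  with G0 have A0: "fps_nth A 0 = 0" by simp
  have AB: "fps_nth A n \<in> S \<and> fps_nth B n \<in> S" for n
  proof (induction n rule: less_induct)
    case (less n)
    have "fps_nth (fps_X * (B * B - fps_const b * (B + A * B))) n \<in> S"
    proof (cases n)
      case 0
      then show ?thesis by (simp add: subring_0)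
    next
      case (Suc k)
      then have "fps_nth A i \<in> S" "fps_nth B i \<in> S" if "i \<le> k" for i
        using less that by auto
      then show ?thesis using Suc \<open>b \<in> S\<close>
        by (simp add: S_diff S_mult subring_add subring_fps_mult_nth)
    qed
    moreover have "fps_nth (A * A) n \<in> S"
      unfolding fps_mult_nth
    proof (rule subring_sum)
      fix i assume "i \<in> {0..n}"
      then consider "i = 0" | "i = n" | "i < n" "n - i < n" by force
      then show "fps_nth A i * fps_nth A (n - i) \<in> S"
        by cases (use A0 less in \<open>simp_all add: subring_0 S_mult\<close>)
    qed
    ultimately have An: "fps_nth A n \<in> S"
      by (subst A) (simp only: fps_sub_nth S_diff)
    \<comment> \<open>The coefficient of \<open>z^(2n+1)\<close> in \<open>z B(t)\<close> is that of
      \<open>z^(2n)\<close> in \<open>B(t)\<close>, where \<open>B_n\<close> occurs with factor 1;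
      so \<open>B_n\<close> can be isolated without division.\<close>
    have "{0..2 * n} = insert n ({0..2 * n} - {n})" by auto
    then have "fps_nth (B oo ?T) (2 * n) = fps_nth B n * fps_nth (?T ^ n) (2 * n)
        + (\<Sum>i\<in>{0..2 * n} - {n}. fps_nth B i * fps_nth (?T ^ i) (2 * n))"
      unfolding fps_compose_nth by (subst sum.remove[of _ n]) auto
    moreover have "fps_nth (?T ^ n) (2 * n) = 1"
      by (simp add: invar_var_power_nth fps_nth_power_0 fps_geom_def)
    ultimately have "fps_nth B n = fps_nth G (2 * n + 1) - fps_nth (A oo ?T) (2 * n + 1)
        - (\<Sum>i\<in>{0..2 * n} - {n}. fps_nth B i * fps_nth (?T ^ i) (2 * n))"
      by (simp add: G)
    \<comment> \<open>The index \<open>i = n\<close> occurs here, so \<open>A_n\<close> has to be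
      settled before \<open>B_n\<close>.\<close>
    moreover have "fps_nth (A oo ?T) (2 * n + 1) \<in> S"
    proof (rule subring_compose_invar_var_nth[OF \<open>b \<in> S\<close>])
      fix i assume "2 * i \<le> 2 * n + 1"
      then have "i < n \<or> i = n" by auto
      then show "fps_nth A i \<in> S" using less An by auto
    qed
    moreover have "(\<Sum>i\<in>{0..2 * n} - {n}. fps_nth B i * fps_nth (?T ^ i) (2 * n)) \<in> S"
    proof (rule subring_sum)
      fix i assume "i \<in> {0..2 * n} - {n}"
      \<comment> \<open>For \<open>i > n\<close> the order \<open>2 i\<close> of \<open>t^i\<close>
        exceeds \<open>2 n\<close>, so later coefficients of \<open>B\<close> do not enter.\<close>
      then consider "i < n" | "n < i" by force
      then show "fps_nth B i * fps_nth (?T ^ i) (2 * n) \<in> S"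
      proof cases
        case 1
        then show ?thesis using less \<open>b \<in> S\<close> by (intro S_mult subring_invar_var_power_nth) auto
      next
        case 2
        then show ?thesis by (simp add: invar_var_power_nth subring_0)
      qed
    qed
    ultimately have "fps_nth B n \<in> S" using odd[of "2 * n + 1"] S_diff by auto
    with An show ?case by blast
  qed
  have "fps_nth (F oo ?T) k \<in> S" if "F = A \<or> F = B" for F k
    using that AB \<open>b \<in> S\<close> by (auto intro!: subring_compose_invar_var_nth)
  then show ?thesis unfolding G
    by (cases n) (auto simp: A0 subring_0 intro!: subring_add)
qed

end


section \<open>The functional equation\<close>

lemma mconst_0: "mconst 0 = 0" and mconst_1: "mconst 1 = 1"
  and mconst_add: "mconst (c + d) = mconst c + mconst d"
  and mconst_uminus: "mconst (- c) = - mconst c"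
  by (rule mvs_eqI, simp add: mconst_def mcoeff_one)+

lemma mconst_mult: "mconst (c * d) = mconst c * mconst d"
  by (rule mvs_eqI) (simp, simp add: mconst_def)

lemma mconst_power: "mconst (c ^ n) = mconst c ^ n"
  by (induction n) (simp_all add: mconst_1 mconst_mult)

lemma mconst_sum: "mconst (sum f A) = (\<Sum>a\<in>A. mconst (f a))"
  by (induction A rule: infinite_finite_induct) (simp_all add: mconst_0 mconst_add)

lemma fps_mconst_mult: "fps_mconst (F * G) = fps_mconst F * fps_mconst G"
  by (rule fps_ext) (simp add: fps_mconst_def fps_mult_nth mconst_sum mconst_mult)

lemma fps_mconst_add: "fps_mconst (F + G) = fps_mconst F + fps_mconst G"
  by (rule fps_ext) (simp add: fps_mconst_def mconst_add)

lemma fps_mconst_uminus: "fps_mconst (- F) = - fps_mconst F"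
  by (rule fps_ext) (simp add: fps_mconst_def mconst_uminus)

lemma fps_mconst_1: "fps_mconst 1 = 1"
  by (rule fps_ext) (simp add: fps_mconst_def mconst_0 mconst_1)

lemma fps_mconst_const: "fps_mconst (fps_const c) = fps_const (mconst c)"
  by (rule fps_ext) (simp add: fps_mconst_def mconst_0)

lemma fps_mconst_X: "fps_mconst fps_X = fps_X"
  by (rule fps_ext) (simp add: fps_mconst_def fps_X_def mconst_0 mconst_1)

lemma fps_mconst_geom: "fps_mconst (fps_geom c) = fps_geom (mconst c)"
  by (rule fps_ext) (simp add: fps_mconst_def fps_geom_def mconst_power mconst_uminus)

lemma zbar_eq: "zbar = invol_var beta"
proof -
  have "inverse (1 + fps_const beta * fps_X) = fps_geom beta"
    by (rule fps_inverse_unique[OF fps_geom_inverse])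
  then show ?thesis
    by (simp add: zbar_def invol_var_def fps_divide_unit)
qed

lemma fps_mconst_zbar: "fps_mconst zbar = invol_var (mconst beta)"
  by (simp only: zbar_eq invol_var_def fps_mconst_mult fps_mconst_uminus fps_mconst_X
      fps_mconst_geom)

text \<open>As zbar is an involution, substituting it exchanges the numerator
  \<open>1 - x zbar\<close> and the denominator \<open>1 - x z\<close>.\<close>

lemma q_factor_mult_compose: "q_factor i * (q_factor i oo fps_mconst zbar) = 1"
proof -
  let ?x = "fps_const (mvar i) :: Qbeta mvs fps" and ?W = "fps_mconst zbar"
  let ?R = "fps_right_inverse (1 - ?x * fps_X) 1"
  have W0: "fps_nth ?W 0 = 0" by (simp add: fps_mconst_zbar)
  have R: "(1 - ?x * fps_X) * ?R = 1"
    by (rule fps_right_inverse) simp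
  have q: "q_factor i = (1 - ?x * ?W) * ?R" by (simp only: q_factor_def)
  have "q_factor i * (1 - ?x * fps_X) = 1 - ?x * ?W"
    by (simp only: q mult.assoc mult.commute[of ?R] R mult_1_right)
  then have "(q_factor i * (1 - ?x * fps_X)) oo ?W = (1 - ?x * ?W) oo ?W"
    by (simp only:)
  then have c: "(q_factor i oo ?W) * (1 - ?x * ?W) = 1 - ?x * fps_X"
    by (simp only: fps_compose_mult[OF W0] fps_compose_sub_distrib fps_compose_1
        fps_const_compose fps_X_fps_compose_startby0[OF W0])
      (simp only: fps_mconst_zbar invol_var_compose)
  have "q_factor i * (q_factor i oo ?W) = ((q_factor i oo ?W) * (1 - ?x * ?W)) * ?R"
    by (subst q) (simp only: mult_ac)
  then show ?thesis by (simp only: c R)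
qed

text \<open>Allows an infinite product to be replaced by a finite one when only the divisors of a
  fixed monomial matter.\<close>

lemma mcoeff_mult_cong:
  assumes "\<And>a. a \<subseteq># m \<Longrightarrow> mcoeff f a = mcoeff f' a"
    and "\<And>a. a \<subseteq># m \<Longrightarrow> mcoeff g a = mcoeff g' a"
  shows "mcoeff (f * g) m = mcoeff (f' * g') m"
  unfolding mcoeff_mult using assms by (intro sum.cong refl) auto

text \<open>At a monomial \<open>m\<close> only the factors of the variables in \<open>m\<close>
  contribute, which leaves a finite product of factors treated separately.\<close>

lemma q_gf_mult_compose: "q_gf * (q_gf oo fps_mconst zbar) = 1"
proof (rule fps_ext, rule mvs_eqI)
  fix n m
  let ?W = "fps_mconst zbar" and ?P = "\<Prod>i\<in>set_mset m. q_factor i"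
  have W0: "fps_nth ?W 0 = 0" by (simp add: fps_mconst_zbar)
  have q: "mcoeff (fps_nth q_gf k) a = mcoeff (fps_nth ?P k) a" if "a \<subseteq># m" for k a
    using mcoeff_qb[of "set_mset m" a k] set_mset_mono[OF that] by (simp add: qb_def)
  have "mcoeff (fps_nth (q_gf oo ?W) k) a = mcoeff (fps_nth (?P oo ?W) k) a"
    if "a \<subseteq># m" for k a
    unfolding fps_compose_nth mcoeff_sum
    by (intro sum.cong refl mcoeff_mult_cong q) (use that in auto)
  then have "mcoeff (fps_nth (q_gf * (q_gf oo ?W)) n) m = mcoeff (fps_nth (?P * (?P oo ?W)) n) m"
    unfolding fps_mult_nth mcoeff_sum by (intro sum.cong refl mcoeff_mult_cong q) auto
  also have "?P * (?P oo ?W) = (\<Prod>i\<in>set_mset m. q_factor i * (q_factor i oo ?W))"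
    by (simp only: fps_compose_prod[OF W0] prod.distrib)
  also have "\<dots> = 1" by (simp only: q_factor_mult_compose prod.neutral_const)
  finally show "mcoeff (fps_nth (q_gf * (q_gf oo ?W)) n) m = mcoeff (fps_nth 1 n) m" .
qed

lemma qb_0: "qb 0 = 1"
proof (rule mvs_eqI)
  fix m
  have "fps_nth (q_factor i) 0 = 1" for i
    by (simp add: q_factor_altdef fps_mconst_zbar)
  then have "fps_nth (\<Prod>i\<in>I. q_factor i) 0 = 1" for I
    by (induction I rule: infinite_finite_induct) auto
  then show "mcoeff (qb 0) m = mcoeff 1 m"
    by (simp add: mcoeff_qb[of "set_mset m"])
qed

text \<open>The constant term 2 is invertible in the field \<open>Qbeta\<close>;
  \<open>fps_mconst\<close> is multiplicative and carries the inverse over.\<close>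

lemma two_plus_beta_X_unit:
  "(2 + fps_const (mconst beta) * fps_X) * fps_mconst (1 / (2 + fps_const beta * fps_X)) = 1"
proof -
  let ?d = "2 + fps_const beta * fps_X"
  have d0: "fps_nth ?d 0 \<noteq> 0" by (simp add: fps_numeral_nth)
  have "?d * (1 / ?d) = 1"
    using inverse_mult_eq_1'[OF d0] d0 by (simp add: fps_divide_unit)
  then have "fps_mconst ?d * fps_mconst (1 / ?d) = 1"
    by (simp only: fps_mconst_1 flip: fps_mconst_mult)
  moreover have "fps_mconst ?d = 2 + fps_const (mconst beta) * fps_X"
    by (simp only: fps_mconst_add fps_mconst_mult fps_mconst_const fps_mconst_X fps_mconst_1
        flip: one_add_one)
  ultimately show ?thesis by simp
qed

lemma q_gf_eq: "q_gf = 1 + (2 + fps_const (mconst beta) * fps_X) * gp_gf"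
proof -
  have "Abs_fps (\<lambda>n. if n \<ge> 1 then qb n else 0) = q_gf - 1"
    by (rule fps_ext) (use qb_0 in \<open>auto simp: qb_def not_le\<close>)
  then show ?thesis
    unfolding gp_gf_def using two_plus_beta_X_unit by (simp flip: mult.assoc)
qed

lemma gp_gf_relation:
  defines "b \<equiv> mconst beta"
  shows "(1 + fps_const b * fps_X) * gp_gf + (gp_gf oo invol_var b)
      + (2 + fps_const b * fps_X) * gp_gf * (gp_gf oo invol_var b) = 0"
proof -
  let ?W = "invol_var b" and ?v = "2 + fps_const b * fps_X :: Qbeta mvs fps"
  let ?u = "1 + fps_const b * fps_X :: Qbeta mvs fps"
  define H where "H = gp_gf oo ?W"
  obtain R where R: "?v * R = 1" using two_plus_beta_X_unit b_def by blast
  have "q_gf oo ?W = 1 + (2 + fps_const b * ?W) * H"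
    unfolding q_gf_eq H_def b_def[symmetric]
    by (simp only: fps_compose_add_distrib fps_compose_1 fps_compose_mult[OF invol_var_nth_0]
        numeral_compose fps_const_compose fps_X_fps_compose_startby0[OF invol_var_nth_0])
  then have prod: "(1 + ?v * gp_gf) * (1 + (2 + fps_const b * ?W) * H) = 1"
    using q_gf_mult_compose by (simp only: fps_mconst_zbar b_def[symmetric] q_gf_eq)
  \<comment> \<open>By \<open>(1 + b z) zbar = - z\<close> the product is
    \<open>2 + 2 b z - b z\<close>. Hence multiplying \<open>Q(z) Q(zbar) - 1 = 0\<close> by
    \<open>?u\<close> makes \<open>?v\<close> a common factor.\<close>
  have "?u * (2 + fps_const b * ?W) = ?v"
    by (simp only: distrib_left mult.left_commute[of ?u] invol_var_mult)
      (simp add: algebra_simps)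
  moreover have "v * (u * g + h + v * g * h) = u * ((1 + v * g) * (1 + w * h) - 1)"
    if "u * w = v" for u v w g h :: "Qbeta mvs fps"
    unfolding that[symmetric] by (simp add: algebra_simps)
  ultimately have "?v * (?u * gp_gf + H + ?v * gp_gf * H)
      = ?u * ((1 + ?v * gp_gf) * (1 + (2 + fps_const b * ?W) * H) - 1)"
    by blast
  then have "?v * (?u * gp_gf + H + ?v * gp_gf * H) = ?v * 0"
    by (simp only: prod diff_self mult_zero_right)
  then have "?u * gp_gf + H + ?v * gp_gf * H = 0" by (rule unit_cancel[OF R])
  then show ?thesis by (simp only: H_def)
qed


section \<open>Generation by the odd functions\<close>

lemma beta_in_Zbeta: "beta \<in> Zbeta"
  unfolding Zbeta_def beta_def by (rule range_eqI[of _ _ "[:0, 1:]"]) (simp add: map_poly_pCons)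

text \<open>Scaling by -1 supplies the differences, since \<open>Zbeta_subalgebra\<close> lists only
  sums, products and scalings.\<close>

lemma minus_1_in_Zbeta: "- 1 \<in> Zbeta"
  unfolding Zbeta_def
  by (rule range_eqI[of _ _ "[:- 1:]"]) (simp add: map_poly_pCons poly_embed_def One_fract_def one_pCons)

theorem theorem4p4:
  shows "gGamma_Z = Zbeta_adjoin {gp n | n. odd n}"
proof
  let ?O = "{gp n | n. odd n}" and ?A = "Zbeta_adjoin {gp n | n. odd n}"
  have "?O \<subseteq> {gp n | n. n \<ge> 1}" by (auto dest: odd_pos simp: Suc_le_eq)
  then show "?A \<subseteq> gGamma_Z" unfolding gGamma_Z_def Zbeta_adjoin_def by (rule hull_mono)
  have alg: "Zbeta_subalgebra ?A"
    by (rule Zbeta_subalgebra_adjoin) (auto simp: gp_in_Lam)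
  then have A1: "1 \<in> ?A"
    and Amult: "\<And>f g. f \<in> ?A \<Longrightarrow> g \<in> ?A \<Longrightarrow> f * g \<in> ?A"
    and Aadd: "\<And>f g. f \<in> ?A \<Longrightarrow> g \<in> ?A \<Longrightarrow> f + g \<in> ?A"
    and Ascale: "\<And>c f. c \<in> Zbeta \<Longrightarrow> f \<in> ?A \<Longrightarrow> mconst c * f \<in> ?A"
    by (auto simp: Zbeta_subalgebra_def)
  have Adiff: "f - g \<in> ?A" if "f \<in> ?A" "g \<in> ?A" for f g
    using Aadd[OF that(1) Ascale[OF minus_1_in_Zbeta that(2)]] by (simp add: mconst_uminus mconst_1)
  \<comment> \<open>The recursion needs beta as an element of the subring, not only as a
    scalar.\<close>
  have b: "mconst beta \<in> ?A"
    using Ascale[OF beta_in_Zbeta A1] by simp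
  have "?O \<subseteq> ?A" unfolding Zbeta_adjoin_def by (rule hull_subset)
  then have odd: "fps_nth gp_gf n \<in> ?A" if "odd n" for n
    using that by (auto simp: gp_def)
  \<comment> \<open>The series defining \<open>gp_gf\<close> starts at index 1; this provides
    \<open>A_0 = 0\<close> in the recursion.\<close>
  have "fps_nth gp_gf 0 = 0" by (simp add: gp_gf_def)
  then have "gp n \<in> ?A" for n
    using subring_coeffs_if_relation[where S = ?A, OF A1 _ _ b _ gp_gf_relation
        two_plus_beta_X_unit] Adiff Amult odd
    unfolding gp_def by blast
  then show "gGamma_Z \<subseteq> ?A"
    unfolding gGamma_Z_def using alg
    by (subst Zbeta_adjoin_def, intro hull_minimal) auto
qed

end
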